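(* Let $m\ge 2$ and let $n$ be a multiple of $m$ with $n > 4m^2-6m$. Then every $n$-vertex tournament has an $m$-star-factor.
   Context: A tournament is an orientation of a complete graph. For $m\ge 2$, the $m$-star $S_m$ is the digraph on $m$ vertices consisting of $m-1$ edges with a common tail (the source) and $m-1$ distinct heads. For a tournament $T$ on $n$ vertices with $m \mid n$, an $m$-star-factor of $T$ is a spanning subgraph of $T$ consisting of $n/m$ pairwise vertex-disjoint copies of $S_m$. *)

theory Defs
  imports "Graph_Theory.Graph_Theory"
begin

locale tournament = digraph T for T :: "('a, 'b) pre_digraph" (structure) +
  assumes one_direction:
    "\<lbrakk>u \<in> verts T; v \<in> verts T; u \<noteq> v\<rbrakk> \<Longrightarrow> (u \<rightarrow> v) \<noteq> (v \<rightarrow> u)"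

text \<open>The star on \<open>m\<close> vertices, with source \<open>0\<close> and leaves \<open>1, \<dots>, m - 1\<close>.\<close>

definition m_star :: "nat \<Rightarrow> (nat, nat \<times> nat) pre_digraph" where
  "m_star m = with_proj \<lparr> pverts = {0..<m}, parcs = {0} \<times> {1..<m} \<rparr>"

definition m_star_factor :: "nat \<Rightarrow> ('a, 'b) pre_digraph \<Rightarrow> ('a, 'b) pre_digraph \<Rightarrow> bool" where
  "m_star_factor m F T \<longleftrightarrow>
     m dvd card (verts T) \<and>
     spanning F T \<and>
     (\<exists>\<H>. finite \<H> \<and> card \<H> = card (verts T) div m \<and>
          (\<forall>H \<in> \<H>. subgraph H T \<and> digraph_iso (m_star m) H) \<and>
          pairwise (\<lambda>H H'. verts H \<inter> verts H' = {}) \<H> \<and>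
          F = pre_digraph.Union T \<H>)"

end

theory Submission
  imports Defs "HOL-Library.Disjoint_Sets"
begin

text \<open>
  Put \<open>k = m - 1\<close>. By averaging out-degrees, any \<open>2k\<close> vertices contain a star with \<open>k\<close> leaves. Let
  \<open>w\<close> be a vertex of maximum out-degree, so that its out-neighbourhood \<open>W\<close> has at least
  \<open>(k + 1)(2k - 1) = k(2k - 1) + 2k - 1\<close> vertices. Remove stars greedily from the vertices outside
  \<open>W \<union> {w}\<close> until a set \<open>L\<close> of at most \<open>2k - 1\<close> vertices is left. Each \<open>v \<in> L\<close> in turn is put
  into a star whose other \<open>k\<close> vertices come from \<open>W\<close>, of which at least \<open>3k - 1\<close> are still
  available: either \<open>v\<close> dominates \<open>k\<close> of them, or at least \<open>2k\<close> of them dominate \<open>v\<close> and so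
  contain a star with \<open>k - 1\<close> leaves, to which \<open>v\<close> is added as a leaf. Finally remove stars greedily
  from what remains of \<open>W\<close>; by divisibility exactly \<open>k\<close> vertices survive, and they form a star with
  source \<open>w\<close>.
\<close>

definition out_nbrs :: "('a \<Rightarrow> 'a \<Rightarrow> bool) \<Rightarrow> 'a set \<Rightarrow> 'a \<Rightarrow> 'a set" where
  "out_nbrs R U u = {v \<in> U. v \<noteq> u \<and> R u v}"

lemma totalp_on_card_square_le_sum_out_nbrs:
  assumes "totalp_on U R" "finite U"
  shows "card U * card U \<le> (\<Sum>u\<in>U. 2 * card (out_nbrs R U u) + 1)"
proof -
  let ?E = "Sigma U (out_nbrs R U)"
  have finite_out_nbrs: "finite (out_nbrs R U u)" for u
    using assms(2) by (simp add: out_nbrs_def)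
  have "U \<times> U \<subseteq> ?E \<union> ?E\<inverse> \<union> Id_on U"
    using assms(1) by (fastforce simp: out_nbrs_def totalp_on_def)
  then have "card (U \<times> U) \<le> card (?E \<union> ?E\<inverse> \<union> Id_on U)"
    using assms(2) finite_out_nbrs by (intro card_mono) (auto simp: Id_on_def)
  also have "\<dots> \<le> card ?E + card (?E\<inverse>) + card (Id_on U)"
    by (meson add_mono card_Un_le order_refl order_trans)
  also have "card (Id_on U) = card U"
    unfolding Id_on_def by (simp add: UNION_singleton_eq_range card_image inj_on_def)
  also have "card ?E = (\<Sum>u\<in>U. card (out_nbrs R U u))"
    using assms(2) finite_out_nbrs by simp
  finally show ?thesis
    using assms(2) finite_out_nbrs
    by (simp add: card_cartesian_product sum.distrib sum_distrib_left mult_2 sum_Suc)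
qed

lemma totalp_on_ex_large_out_nbrs:
  assumes "totalp_on U R" "finite U" "U \<noteq> {}"
  obtains u where "u \<in> U" "card U \<le> 2 * card (out_nbrs R U u) + 1"
proof -
  have "\<exists>u\<in>U. card U \<le> 2 * card (out_nbrs R U u) + 1"
  proof (rule ccontr)
    assume "\<not> ?thesis"
    then have "(\<Sum>u\<in>U. 2 * card (out_nbrs R U u) + 1) < (\<Sum>u\<in>U. card U)"
      using assms(2,3) by (intro sum_strict_mono) (auto simp: not_le)
    then show False
      using totalp_on_card_square_le_sum_out_nbrs[OF assms(1,2)] by simp
  qed
  then show ?thesis
    using that by blast
qed

definition spans_star :: "('a \<Rightarrow> 'a \<Rightarrow> bool) \<Rightarrow> 'a set \<Rightarrow> bool" where
  "spans_star R S \<longleftrightarrow> (\<exists>c\<in>S. \<forall>v\<in>S - {c}. R c v)"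

lemma spans_star_insert_source: "A \<subseteq> out_nbrs R U c \<Longrightarrow> spans_star R (insert c A)"
  by (auto simp: spans_star_def out_nbrs_def)

lemma spans_star_insert_leaf:
  "spans_star R S \<Longrightarrow> (\<And>u. u \<in> S \<Longrightarrow> R u v) \<Longrightarrow> spans_star R (insert v S)"
  unfolding spans_star_def by blast

lemma ex_star_with_source_if_le_card_out_nbrs:
  assumes "k \<le> card (out_nbrs R U c)" "finite U"
  obtains A where "A \<subseteq> U" "c \<notin> A" "card A = k" "spans_star R (insert c A)"
proof -
  obtain A where A: "A \<subseteq> out_nbrs R U c" "card A = k"
    using assms(1) obtain_subset_with_card_n by metis
  then show ?thesis
    using that[of A] spans_star_insert_source[OF A(1)] by (auto simp: out_nbrs_def)
qed

lemma totalp_on_ex_star_subset: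
  assumes "totalp_on U R" "2 * k - 1 < card U"
  obtains S where "S \<subseteq> U" "card S = Suc k" "spans_star R S"
proof -
  have "finite U" "U \<noteq> {}"
    using assms(2) card_gt_0_iff[of U] by auto
  then obtain c where c: "c \<in> U" "card U \<le> 2 * card (out_nbrs R U c) + 1"
    using totalp_on_ex_large_out_nbrs assms(1) by metis
  then have "k \<le> card (out_nbrs R U c)"
    using assms(2) by linarith
  then obtain A where "A \<subseteq> U" "c \<notin> A" "card A = k" "spans_star R (insert c A)"
    using ex_star_with_source_if_le_card_out_nbrs \<open>finite U\<close> by metis
  with c(1) \<open>finite U\<close> show ?thesis
    by (intro that[of "insert c A"]) (auto simp: finite_subset)
qed

definition star_tileable :: "('a \<Rightarrow> 'a \<Rightarrow> bool) \<Rightarrow> nat \<Rightarrow> 'a set \<Rightarrow> bool" where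
  "star_tileable R m U \<longleftrightarrow>
     (\<exists>P. partition_on U P \<and> (\<forall>S\<in>P. card S = m \<and> spans_star R S))"

lemma star_tileable_empty: "star_tileable R m {}"
  by (auto simp: star_tileable_def partition_on_empty)

lemma star_tileable_star: "card S = m \<Longrightarrow> spans_star R S \<Longrightarrow> star_tileable R m S"
  unfolding star_tileable_def
  by (intro exI[of _ "{S}"]) (auto simp: spans_star_def intro!: partition_on_space)

lemma star_tileable_Un:
  assumes "star_tileable R m U" "star_tileable R m V" "U \<inter> V = {}"
  shows "star_tileable R m (U \<union> V)"
proof -
  obtain P Q where P: "partition_on U P" "\<forall>S\<in>P. card S = m \<and> spans_star R S"
    and Q: "partition_on V Q" "\<forall>S\<in>Q. card S = m \<and> spans_star R S"
    using assms(1,2) by (auto simp: star_tileable_def)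
  have "partition_on (U \<union> V) (P \<union> Q)"
    using P(1) Q(1) assms(3) by (auto simp: partition_on_def intro!: disjoint_union)
  with P(2) Q(2) show ?thesis
    by (auto simp: star_tileable_def)
qed

lemma card_eq_mult_card_partition:
  assumes "partition_on U P" "finite U" "\<And>S. S \<in> P \<Longrightarrow> card S = m"
  shows "card U = m * card P"
proof -
  have "m * card P = card (\<Union>P)"
    using assms by (intro card_partition) (auto simp: partition_on_def disjoint_def finite_UnionD)
  then show ?thesis
    using assms(1) by (simp add: partition_on_def)
qed

lemma star_tileable_dvd_card: "star_tileable R m U \<Longrightarrow> finite U \<Longrightarrow> m dvd card U"
  unfolding star_tileable_def by (metis card_eq_mult_card_partition dvd_triv_left)

lemma ex_star_tileable_up_to_small_set:
  assumes "totalp_on U R" "finite U"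
  obtains L where "L \<subseteq> U" "card L \<le> 2 * k - 1" "star_tileable R (Suc k) (U - L)"
proof -
  let ?leftover = "\<lambda>L. L \<subseteq> U \<and> star_tileable R (Suc k) (U - L)"
  have "?leftover U"
    by (simp add: star_tileable_empty)
  then obtain L where L: "?leftover L" and minimal: "\<And>L'. ?leftover L' \<Longrightarrow> card L \<le> card L'"
    using ex_has_least_nat[of ?leftover U card] by blast
  have "card L \<le> 2 * k - 1"
  proof (rule ccontr)
    assume "\<not> ?thesis"
    then obtain S where S: "S \<subseteq> L" "card S = Suc k" "spans_star R S"
      using totalp_on_ex_star_subset totalp_on_subset[OF assms(1)] L by (metis not_le)
    have "star_tileable R (Suc k) ((U - L) \<union> S)"
      using L S by (intro star_tileable_Un[OF _ star_tileable_star]) auto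
    moreover have "(U - L) \<union> S = U - (L - S)"
      using L S(1) by blast
    ultimately have "card L \<le> card (L - S)"
      using L by (intro minimal) auto
    moreover have "S \<noteq> {}"
      using S(2) by auto
    then have "L - S \<subset> L"
      using S(1) by blast
    then have "card (L - S) < card L"
      using L assms(2) by (meson finite_subset psubset_card_mono)
    ultimately show False
      by simp
  qed
  then show ?thesis
    using that L by blast
qed

lemma ex_star_tileable_insert_subset:
  assumes "totalp_on (insert v W) R" "finite W" "v \<notin> W" "3 * k \<le> card W + 1"
  obtains A where "A \<subseteq> W" "card A = k" "star_tileable R (Suc k) (insert v A)"
proof (cases "k \<le> card (out_nbrs R W v)")
  case True
  then obtain A where "A \<subseteq> W" "v \<notin> A" "card A = k" "spans_star R (insert v A)"
    using ex_star_with_source_if_le_card_out_nbrs assms(2) by metis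
  then show ?thesis
    using assms(2) by (intro that[of A] star_tileable_star) (auto simp: finite_subset)
next
  case False
  then obtain j where j: "k = Suc j"
    using not0_implies_Suc by fastforce
  define I where "I = W - out_nbrs R W v"
  have "card I = card W - card (out_nbrs R W v)"
    unfolding I_def using assms(2) by (intro card_Diff_subset) (auto simp: out_nbrs_def)
  then have "2 * j - 1 < card I"
    using False assms(4) j by linarith
  moreover have "totalp_on I R"
    using assms(1) by (rule totalp_on_subset) (auto simp: I_def)
  ultimately obtain S where S: "S \<subseteq> I" "card S = k" "spans_star R S"
    using totalp_on_ex_star_subset j by metis
  have "R u v" if "u \<in> I" for u
    using that assms(1,3) by (auto simp: I_def out_nbrs_def totalp_on_def)
  then have "spans_star R (insert v S)"
    using S by (intro spans_star_insert_leaf) auto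
  moreover have "S \<subseteq> W"
    using S(1) by (auto simp: I_def)
  moreover have "card (insert v S) = Suc k"
    using S(2) \<open>S \<subseteq> W\<close> assms(2,3) by (subst card_insert_disjoint) (auto simp: finite_subset)
  ultimately show ?thesis
    using S(2) by (intro that[of S] star_tileable_star)
qed

lemma ex_star_tileable_Un_subset:
  assumes "finite L" "totalp_on (L \<union> W) R" "finite W" "L \<inter> W = {}"
    and "k * (card L + 2) \<le> card W + 1"
  shows "\<exists>B\<subseteq>W. star_tileable R (Suc k) (L \<union> B)"
  using assms
proof (induction L arbitrary: W rule: finite_induct)
  case empty
  then show ?case
    using star_tileable_empty by auto
next
  case (insert v L)
  have "totalp_on (insert v W) R"
    using insert.prems(1) by (rule totalp_on_subset) auto
  moreover have card_W_large: "k * (card L + 2) + k \<le> card W + 1"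
    using insert.prems(4) insert.hyps by (simp add: algebra_simps)
  then have "3 * k \<le> card W + 1"
    by (simp add: algebra_simps)
  ultimately obtain A where A: "A \<subseteq> W" "card A = k" "star_tileable R (Suc k) (insert v A)"
    using insert.prems ex_star_tileable_insert_subset[of v W R k] by blast
  have "card (W - A) = card W - k"
    using A insert.prems(2) by (simp add: card_Diff_subset finite_subset)
  then have "k * (card L + 2) \<le> card (W - A) + 1"
    using card_W_large by linarith
  moreover have "totalp_on (L \<union> (W - A)) R"
    using insert.prems(1) by (rule totalp_on_subset) auto
  ultimately obtain B where B: "B \<subseteq> W - A" "star_tileable R (Suc k) (L \<union> B)"
    using insert.IH[of "W - A"] insert.prems by auto
  have "star_tileable R (Suc k) (insert v A \<union> (L \<union> B))"
    using A(1) B(1) insert.prems(3) insert.hyps by (intro star_tileable_Un[OF A(3) B(2)]) auto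
  moreover have "insert v A \<union> (L \<union> B) = insert v L \<union> (A \<union> B)"
    by auto
  ultimately show ?case
    using A(1) B(1) by (intro exI[of _ "A \<union> B"]) auto
qed

lemma ex_star_tileable_complement_Un_subset:
  assumes "totalp_on V R" "finite V" "W \<subseteq> V" "k * (2 * k + 1) \<le> card W + 1"
  obtains B where "B \<subseteq> W" "star_tileable R (Suc k) ((V - W) \<union> B)"
proof -
  obtain L where L: "L \<subseteq> V - W" "card L \<le> 2 * k - 1" "star_tileable R (Suc k) (V - W - L)"
    using ex_star_tileable_up_to_small_set[of "V - W" R] totalp_on_subset[OF assms(1)] assms(2)
    by (metis Diff_subset finite_Diff)
  have "k * (card L + 2) \<le> k * (2 * k + 1)"
    using L(2) mult_le_mono2[of "card L + 2" "2 * k + 1" k] by (cases "k = 0") simp_all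
  moreover have "totalp_on (L \<union> W) R"
    using assms(1) by (rule totalp_on_subset) (use L(1) assms(3) in auto)
  moreover have "finite L" "finite W" "L \<inter> W = {}"
    using L(1) assms(2,3) by (auto intro: finite_subset)
  ultimately obtain B where B: "B \<subseteq> W" "star_tileable R (Suc k) (L \<union> B)"
    using ex_star_tileable_Un_subset[of L W R k] assms(4) by fastforce
  have "star_tileable R (Suc k) ((V - W - L) \<union> (L \<union> B))"
    using L(1) B(1) by (intro star_tileable_Un[OF L(3) B(2)]) auto
  moreover have "(V - W - L) \<union> (L \<union> B) = (V - W) \<union> B"
    using L(1) by auto
  ultimately show ?thesis
    using B(1) that by simp
qed

lemma star_tileable_if_small_remainder:
  assumes "star_tileable R (Suc k) (V - insert w Z)" "finite V" "w \<in> V"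
    and "Z \<subseteq> out_nbrs R V w" "card Z \<le> 2 * k" "Suc k dvd card V"
  shows "star_tileable R (Suc k) V"
proof -
  have Z: "insert w Z \<subseteq> V" "w \<notin> Z" "finite Z"
    using assms(2-4) by (auto simp: out_nbrs_def intro: finite_subset)
  then have "card V = card (V - insert w Z) + card (insert w Z)"
    using assms(2) by (metis card_Diff_subset card_mono finite_insert le_add_diff_inverse2)
  moreover have "Suc k dvd card (V - insert w Z)"
    using assms(1,2) by (intro star_tileable_dvd_card) auto
  ultimately have "Suc k dvd card (insert w Z)"
    using assms(6) by (metis dvd_add_right_iff)
  then obtain q where q: "card (insert w Z) = Suc k * q" ..
  then have "0 < Suc k * q" "Suc k * q < Suc k * 2"
    using Z assms(5) by auto
  then have "0 < q" "q < 2"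
    by (simp_all only: mult_less_cancel1 nat_0_less_mult_iff)
  then have "q = 1"
    by linarith
  then have "star_tileable R (Suc k) (insert w Z)"
    using q assms(4) by (intro star_tileable_star spans_star_insert_source) auto
  then have "star_tileable R (Suc k) ((V - insert w Z) \<union> insert w Z)"
    using assms(1) by (intro star_tileable_Un) auto
  then show ?thesis
    using Z(1) by (metis Diff_partition Un_commute)
qed

lemma totalp_on_star_tileable:
  assumes "totalp_on V R" "finite V" "Suc k dvd card V"
    and "card V > 2 * Suc k * (2 * k - 1)"
  shows "star_tileable R (Suc k) V"
proof -
  have "V \<noteq> {}"
    using assms(4) by auto
  then obtain w where w: "w \<in> V" "card V \<le> 2 * card (out_nbrs R V w) + 1"
    using totalp_on_ex_large_out_nbrs assms(1,2) by metis
  define W where "W = out_nbrs R V w"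
  have W: "W \<subseteq> V - {w}" "finite W"
    using assms(2) by (auto simp: W_def out_nbrs_def)
  have "Suc k * (2 * k - 1) \<le> card W"
    using w(2) assms(4) unfolding W_def by linarith
  then have "k * (2 * k + 1) \<le> card W + 1"
    by (cases k) auto
  then obtain B where B: "B \<subseteq> W" "star_tileable R (Suc k) ((V - {w} - W) \<union> B)"
    using ex_star_tileable_complement_Un_subset[of "V - {w}" R W k] assms(1,2) W
    by (metis Diff_subset finite_Diff totalp_on_subset)
  obtain Z where Z: "Z \<subseteq> W - B" "card Z \<le> 2 * k - 1" "star_tileable R (Suc k) (W - B - Z)"
    using ex_star_tileable_up_to_small_set[of "W - B" R] totalp_on_subset[OF assms(1), of "W - B"] W
    by auto
  have "star_tileable R (Suc k) ((V - {w} - W) \<union> B \<union> (W - B - Z))"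
    using B(1) Z(1) by (intro star_tileable_Un[OF B(2) Z(3)]) auto
  moreover have "(V - {w} - W) \<union> B \<union> (W - B - Z) = V - insert w Z"
    using B(1) Z(1) W(1) by auto
  ultimately show ?thesis
    using Z assms(2,3) w(1)
    by (intro star_tileable_if_small_remainder[of R k V w Z]) (auto simp: W_def)
qed

lemma (in wf_digraph) digraph_iso_m_starI:
  assumes "verts G = insert c A" "c \<notin> A" "finite A"
    and "\<And>e. e \<in> arcs G \<Longrightarrow> tail G e = c" "bij_betw (head G) (arcs G) A"
  shows "digraph_iso (m_star (Suc (card A))) G"
proof -
  let ?leaves = "{1..<Suc (card A)}"
  obtain g where g: "bij_betw g A ?leaves"
    using finite_same_card_bij[of A ?leaves] assms(3) by auto
  define h where "h = \<lparr>iso_verts = \<lambda>v. if v = c then 0 else g v, iso_arcs = \<lambda>e. (0, g (head G e)),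
    iso_head = snd, iso_tail = fst\<rparr>"
  have g_head: "bij_betw (g \<circ> head G) (arcs G) ?leaves"
    using assms(5) g by (rule bij_betw_trans)
  have "bij_betw (iso_verts h) A ?leaves"
    using g assms(2) by (subst bij_betw_cong[of _ _ g]) (auto simp: h_def)
  moreover have "{0..<Suc (card A)} = insert 0 ?leaves"
    by auto
  ultimately have bij_verts: "bij_betw (iso_verts h) (verts G) {0..<Suc (card A)}"
    using bij_betw_combine[of "iso_verts h" "{c}" "{0}" A ?leaves] assms(1)
    by (simp add: bij_betw_def h_def)
  have "bij_betw (Pair 0) ?leaves ({0} \<times> ?leaves)"
    by (auto simp: bij_betw_def inj_on_def)
  from bij_betw_trans[OF g_head this]
  have bij_arcs: "bij_betw (iso_arcs h) (arcs G) ({0} \<times> ?leaves)"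
    by (simp add: h_def comp_def)
  have "head G e \<noteq> c" if "e \<in> arcs G" for e
    using that assms(2,5) bij_betwE by fastforce
  then have "digraph_isomorphism h"
    using bij_verts bij_arcs assms(4) wf_digraph
    by (auto simp: digraph_isomorphism_def bij_betw_def h_def)
  moreover have "m_star (Suc (card A)) = app_iso h G"
    using bij_verts bij_arcs
    by (simp add: app_iso_def m_star_def with_proj_def bij_betw_def h_def)
  ultimately have "digraph_iso G (m_star (Suc (card A)))"
    unfolding digraph_iso_def by blast
  then show ?thesis
    by (rule digraph_iso_swap[OF wf_digraph])
qed

lemma (in wf_digraph) ex_m_star_subgraph_if_spans_star:
  assumes "spans_star (dominates G) S" "S \<subseteq> verts G" "finite S"
  obtains H where "subgraph H G" "digraph_iso (m_star (card S)) H" "verts H = S"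
proof -
  obtain c where c: "c \<in> S" "\<And>v. v \<in> S - {c} \<Longrightarrow> dominates G c v"
    using assms(1) by (auto simp: spans_star_def)
  let ?out_arcs = "{e \<in> arcs G. tail G e = c}"
  have "S - {c} \<subseteq> head G ` ?out_arcs"
    using c(2) by (fastforce simp: arcs_ends_conv)
  then obtain E where E: "E \<subseteq> ?out_arcs" "inj_on (head G) E" "S - {c} = head G ` E"
    by (auto simp: subset_image_inj)
  define H where "H = \<lparr>verts = S, arcs = E, tail = tail G, head = head G\<rparr>"
  interpret H: wf_digraph H
    using E c(1) by unfold_locales (auto simp: H_def)
  have "bij_betw (head G) E (S - {c})"
    using E by (simp add: bij_betw_def)
  then have "digraph_iso (m_star (Suc (card (S - {c})))) H"
    using E(1) c(1) assms(3) by (intro H.digraph_iso_m_starI) (auto simp: H_def)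
  then have "digraph_iso (m_star (card S)) H"
    using c(1) assms(3) by (simp only: card_Suc_Diff1)
  moreover have "subgraph H G"
    using assms(2) E(1) H.wf_digraph wf_digraph by (auto simp: subgraph_def compatible_def H_def)
  ultimately show ?thesis
    using that[of H] by (simp add: H_def)
qed

lemma (in wf_digraph) subgraph_Union:
  assumes "\<And>H. H \<in> \<H> \<Longrightarrow> subgraph H G"
  shows "subgraph (Union \<H>) G"
proof -
  have "wf_digraph (Union \<H>)"
  proof
    fix e assume "e \<in> arcs (Union \<H>)"
    then obtain H where H: "H \<in> \<H>" "e \<in> arcs H"
      by (auto simp: Union_def)
    then have "tail G e \<in> verts H" "head G e \<in> verts H"
      using assms[OF H(1)] by (auto simp: subgraph_def compatible_def wf_digraph_def)
    then show "tail (Union \<H>) e \<in> verts (Union \<H>)" "head (Union \<H>) e \<in> verts (Union \<H>)"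
      using H(1) by (auto simp: Union_def)
  qed
  then show ?thesis
    using assms wf_digraph by (fastforce simp: subgraph_def Union_def compatible_def)
qed

lemma (in fin_digraph) ex_m_star_factor_if_star_tileable:
  assumes "star_tileable (dominates G) m (verts G)" "m > 0"
  shows "\<exists>F. m_star_factor m F G"
proof -
  obtain P where P: "partition_on (verts G) P"
    and stars: "\<And>S. S \<in> P \<Longrightarrow> card S = m \<and> spans_star (dominates G) S"
    using assms(1) by (auto simp: star_tileable_def)
  have subset: "S \<subseteq> verts G" if "S \<in> P" for S
    using P that by (auto simp: partition_on_def)
  have "\<exists>H. subgraph H G \<and> digraph_iso (m_star m) H \<and> verts H = S" if "S \<in> P" for S
    using ex_m_star_subgraph_if_spans_star stars subset that finite_subset finite_verts by metis
  then obtain H where H: "\<And>S. S \<in> P \<Longrightarrow>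
      subgraph (H S) G \<and> digraph_iso (m_star m) (H S) \<and> verts (H S) = S"
    by metis
  have card_verts: "card (verts G) = m * card P"
    using P stars by (intro card_eq_mult_card_partition) auto
  moreover have "inj_on H P"
    using H by (metis inj_onI)
  ultimately have "card (H ` P) = card (verts G) div m"
    using assms(2) by (simp add: card_image)
  moreover have "finite (H ` P)"
    using finite_elements[OF finite_verts P] by simp
  moreover have "pairwise (\<lambda>H1 H2. verts H1 \<inter> verts H2 = {}) (H ` P)"
    using partition_onD2[OF P] H by (simp add: pairwise_image pairwise_def disjnt_def) metis
  moreover have "spanning (Union (H ` P)) G"
    using subgraph_Union[of "H ` P"] H P by (auto simp: spanning_def Union_def partition_on_def)
  ultimately have "m_star_factor m (Union (H ` P)) G"
    unfolding m_star_factor_def using card_verts H by (auto intro!: exI[of _ "H ` P"])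
  then show ?thesis ..
qed

lemma (in tournament) totalp_on_dominates: "totalp_on (verts T) (dominates T)"
  using one_direction by (auto intro: totalp_onI)

theorem theorem2:
  fixes m n :: nat and T :: "('a, 'b) pre_digraph"
  assumes "m \<ge> 2"
    and "m dvd n"
    and "int n > 4 * (int m)\<^sup>2 - 6 * int m"
    and "tournament T"
    and "card (verts T) = n"
  shows "\<exists>F. m_star_factor m F T"
proof -
  interpret tournament T
    by fact
  obtain k where k: "m = Suc k" "k \<ge> 1"
    using assms(1) by (cases m) auto
  then have "int (2 * Suc k * (2 * k - 1)) < int n"
    using assms(3) by (simp add: power2_eq_square algebra_simps)
  then have "card (verts T) > 2 * Suc k * (2 * k - 1)"
    using assms(5) by linarith
  then have "star_tileable (dominates T) m (verts T)"
    using totalp_on_star_tileable[OF totalp_on_dominates] assms(2,5) k(1) by simp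
  then show ?thesis
    using ex_m_star_factor_if_star_tileable assms(1) by simp
qed

end
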